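(* Let $p=p(n)\in[0,1]$ and let $J_{ij}^{(n)}$ be the Jaccard index of any distinct vertices $i,j\in[n]$ in the Erdős–Rényi random graph $G(n,p)$. Then $\mathbb{E}[J_{ij}^{(n)}]=p/(2-p)$ for all $n\ge2$. In particular, as $np\to\infty$ (with $n\to\infty$), it further follows that $$\mathrm{Var}\big[J_{ij}^{(n)}\big]=\frac{2(1-p)}{n(2-p)^3}\Big(1+O\Big(\frac1{np}\Big)\Big),$$ and $J_{ij}^{(n)}-p/(2-p)$ converges to $0$ in probability.
   Context: $G(n,p)$ is the Erdős–Rényi random graph on the vertex set $[n]=\{1,\dots,n\}$, $n\ge 2$, in which each edge is present independently with probability $p=p(n)$, which may depend on $n$. For $i,j\in[n]$, $I_{ij}$ is the indicator that the edge between $i$ and $j$ is present; thus $I_{ii}=0$, $I_{ij}=I_{ji}$, and $\{I_{ij}:1\le i<j\le n\}$ are independent Bernoulli($p$) variables. With $a\vee b=\max(a,b)$, set for $i\ne j$ $$S_{ij}^{(n)}=\sum_{k\in[n],\,k\ne i,j}I_{ik}I_{jk},\qquad T_{ij}^{(n)}=\sum_{k\in[n],\,k\ne i,j}I_{ik}\vee I_{jk}.$$ The Jaccard index of distinct vertices $i,j$ is $J_{ij}^{(n)}=S_{ij}^{(n)}/T_{ij}^{(n)}$ if $T_{ij}^{(n)}>0$, and by convention $J_{ij}^{(n)}=p/(2-p)$ if $T_{ij}^{(n)}=0$. (So it is the number of common neighbours of $i$ and $j$ divided by the number of vertices other than $i,j$ adjacent to at least one of them.) *)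

theory Defs
  imports "HOL-Probability.Probability" "HOL-Library.Landau_Symbols"
begin

definition edges :: "nat \<Rightarrow> nat set set" where
  "edges n = {e. e \<subseteq> {1..n} \<and> card e = 2}"

text \<open>A graph on \<open>{1..n}\<close> is represented by the characteristic function of its edge set.\<close>

definition er_graph :: "nat \<Rightarrow> real \<Rightarrow> (nat set \<Rightarrow> bool) pmf" where
  "er_graph n p = Pi_pmf (edges n) False (\<lambda>_. bernoulli_pmf p)"

definition edge_ind :: "(nat set \<Rightarrow> bool) \<Rightarrow> nat \<Rightarrow> nat \<Rightarrow> real" where
  "edge_ind g i j = (if i \<noteq> j \<and> g {i, j} then 1 else 0)"

definition common_nbrs :: "nat \<Rightarrow> (nat set \<Rightarrow> bool) \<Rightarrow> nat \<Rightarrow> nat \<Rightarrow> real" where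
  "common_nbrs n g i j = (\<Sum>k\<in>{1..n} - {i, j}. edge_ind g i k * edge_ind g j k)"

definition union_nbrs :: "nat \<Rightarrow> (nat set \<Rightarrow> bool) \<Rightarrow> nat \<Rightarrow> nat \<Rightarrow> real" where
  "union_nbrs n g i j = (\<Sum>k\<in>{1..n} - {i, j}. max (edge_ind g i k) (edge_ind g j k))"

text \<open>The edge probability \<open>p\<close> enters the index itself only through the convention for an
  empty union of neighbourhoods.\<close>

definition jaccard :: "nat \<Rightarrow> real \<Rightarrow> nat \<Rightarrow> nat \<Rightarrow> (nat set \<Rightarrow> bool) \<Rightarrow> real" where
  "jaccard n p i j g =
     (if union_nbrs n g i j > 0 then common_nbrs n g i j / union_nbrs n g i j else p / (2 - p))"

text \<open>Convergence in probability to a constant; the \<open>n\<close>-th random variable lives on its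
  own probability space \<open>M n\<close>.\<close>

definition converges_in_prob ::
  "(nat \<Rightarrow> 'a measure) \<Rightarrow> (nat \<Rightarrow> 'a \<Rightarrow> real) \<Rightarrow> real \<Rightarrow> bool" where
  "converges_in_prob M X c \<longleftrightarrow>
     (\<forall>\<epsilon>>0. (\<lambda>n. measure (M n) {\<omega> \<in> space (M n). \<bar>X n \<omega> - c\<bar> > \<epsilon>}) \<longlonglongrightarrow> 0)"

end

theory Submission
  imports Defs
begin

text \<open>Let \<open>S\<close> and \<open>T\<close> be the numbers of common and of joint neighbours of \<open>i\<close> and \<open>j\<close>, and
  \<open>q = p / (2 - p)\<close>. Given \<open>T\<close>, the variable \<open>S\<close> is binomial with parameters \<open>T\<close> and \<open>q\<close>, so
  \<open>J - q = (S - q T) / T\<close> has mean zero and variance \<open>q (1 - q) E[1 / T; T > 0]\<close>. Since \<open>T\<close> is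
  binomial with parameters \<open>n - 2\<close> and \<open>p (2 - p)\<close>, size biasing evaluates \<open>E[1 / (T + 1)]\<close> and
  \<open>E[1 / ((T + 1) (T + 2))]\<close> up to the event \<open>T = 0\<close>, and these control \<open>E[1 / T; T > 0]\<close> from
  above; a cubic minorant controls it from below. Convergence in probability is Chebyshev's
  inequality.\<close>

section \<open>Conditioning on single edges, and the joint law of the two counts\<close>

lemma expectation_Pi_pmf_insert_bernoulli:
  fixes F :: "('e \<Rightarrow> bool) \<Rightarrow> real"
  assumes "finite A" "x \<notin> A" "0 \<le> p" "p \<le> 1"
  shows "measure_pmf.expectation (Pi_pmf (insert x A) False (\<lambda>_. bernoulli_pmf p)) F =
    p * measure_pmf.expectation (Pi_pmf A False (\<lambda>_. bernoulli_pmf p)) (\<lambda>g. F (g(x := True))) +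
    (1 - p) * measure_pmf.expectation (Pi_pmf A False (\<lambda>_. bernoulli_pmf p)) (\<lambda>g. F (g(x := False)))"
proof -
  let ?P = "Pi_pmf A False (\<lambda>_. bernoulli_pmf p)"
  have fin: "finite (set_pmf ?P)"
    using assms(1) by (auto simp: set_Pi_pmf)
  have "Pi_pmf (insert x A) False (\<lambda>_. bernoulli_pmf p) =
      bernoulli_pmf p \<bind> (\<lambda>y. map_pmf (\<lambda>g. g(x := y)) ?P)"
    using assms(1,2) by (simp add: Pi_pmf_insert' map_pmf_def)
  then have "measure_pmf.expectation (Pi_pmf (insert x A) False (\<lambda>_. bernoulli_pmf p)) F =
      (\<Sum>y\<in>UNIV. pmf (bernoulli_pmf p) y *\<^sub>R
        measure_pmf.expectation (map_pmf (\<lambda>g. g(x := y)) ?P) F)"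
    using fin by (simp only:) (intro pmf_expectation_bind, auto)
  then show ?thesis
    using assms(3,4) by (simp add: UNIV_bool)
qed

text \<open>\<open>joint_mean p m F\<close> is the expectation of \<open>F S T\<close>, where \<open>S\<close> and \<open>T\<close> count the common
  neighbours and the joint neighbours of two vertices among \<open>m\<close> other vertices; the recursion
  conditions on the two edges at one of these.\<close>

primrec joint_mean :: "real \<Rightarrow> nat \<Rightarrow> (nat \<Rightarrow> nat \<Rightarrow> real) \<Rightarrow> real" where
  "joint_mean p 0 F = F 0 0"
| "joint_mean p (Suc m) F =
     p\<^sup>2 * joint_mean p m (\<lambda>s t. F (Suc s) (Suc t)) +
     2 * p * (1 - p) * joint_mean p m (\<lambda>s t. F s (Suc t)) +
     (1 - p)\<^sup>2 * joint_mean p m F"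

text \<open>The two edges at a fresh \<open>k\<close> are independent of all others, so conditioning
  on both reproduces the recursion of \<open>joint_mean\<close>; the two outcomes with exactly one
  edge merge into its factor 2.\<close>

lemma expectation_Pi_pmf_counts:
  fixes a b :: "'k \<Rightarrow> 'e" and F :: "nat \<Rightarrow> nat \<Rightarrow> real"
  assumes "finite K" "inj_on a K" "inj_on b K" "a ` K \<inter> b ` K = {}" "0 \<le> p" "p \<le> 1"
  shows "measure_pmf.expectation (Pi_pmf (a ` K \<union> b ` K) False (\<lambda>_. bernoulli_pmf p))
      (\<lambda>g. F (card {k \<in> K. g (a k) \<and> g (b k)}) (card {k \<in> K. g (a k) \<or> g (b k)})) =
    joint_mean p (card K) F"
  using assms
proof (induction K arbitrary: F rule: finite_induct)
  case empty
  then show ?case by simp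
next
  case (insert k K)
  let ?A = "a ` K \<union> b ` K"
  let ?S = "\<lambda>K g. card {k \<in> K. g (a k) \<and> g (b k)}"
  let ?T = "\<lambda>K g. card {k \<in> K. g (a k) \<or> g (b k)}"
  have fin: "finite ?A" and nb: "b k \<notin> ?A" and na: "a k \<notin> insert (b k) ?A"
    using insert.hyps insert.prems by auto
  have IH: "measure_pmf.expectation (Pi_pmf ?A False (\<lambda>_. bernoulli_pmf p))
      (\<lambda>g. G (?S K g) (?T K g)) = joint_mean p (card K) G" for G
  proof -
    have "inj_on a K" "inj_on b K" "a ` K \<inter> b ` K = {}"
      using insert.prems by auto
    then show ?thesis
      by (rule insert.IH[OF _ _ _ insert.prems(4,5)])
  qed
  \<comment> \<open>One claim serves both counts: \<open>c\<close> becomes conjunction for common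
    neighbours and disjunction for joint ones. Resetting the edges at \<open>k\<close> leaves the
    edges at the other vertices alone.\<close>
  have count: "card {l \<in> insert k K. c ((g(b k := v, a k := u)) (a l)) ((g(b k := v, a k := u)) (b l))} =
      (if c u v then Suc (card {l \<in> K. c (g (a l)) (g (b l))}) else card {l \<in> K. c (g (a l)) (g (b l))})"
    for c :: "bool \<Rightarrow> bool \<Rightarrow> bool" and g u v
  proof -
    define h where "h = g(b k := v, a k := u)"
    have k: "h (a k) = u" "h (b k) = v"
      using na by (auto simp: h_def)
    have "a l \<noteq> a k \<and> a l \<noteq> b k \<and> b l \<noteq> a k \<and> b l \<noteq> b k" if "l \<in> K" for l
      using na nb that by (metis UnI1 UnI2 imageI insertCI)
    then have K: "h (a l) = g (a l)" "h (b l) = g (b l)" if "l \<in> K" for l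
      using that by (simp_all add: h_def)
    have "{l \<in> insert k K. c (h (a l)) (h (b l))} =
        (if c u v then insert k {l \<in> K. c (g (a l)) (g (b l))} else {l \<in> K. c (g (a l)) (g (b l))})"
      using k K by auto
    then show ?thesis
      unfolding h_def [symmetric] using insert.hyps by simp
  qed
  note S = count[of "(\<and>)"] and T = count[of "(\<or>)"]
  have eq: "a ` insert k K \<union> b ` insert k K = insert (a k) (insert (b k) ?A)"
    by auto
  let ?E = "\<lambda>A. measure_pmf.expectation (Pi_pmf A False (\<lambda>_. bernoulli_pmf p))"
  let ?G = "\<lambda>g. F (?S (insert k K) g) (?T (insert k K) g)"
  have Eb: "?E (insert (b k) ?A) H =
      p * ?E ?A (\<lambda>g. H (g(b k := True))) + (1 - p) * ?E ?A (\<lambda>g. H (g(b k := False)))" for H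
    by (rule expectation_Pi_pmf_insert_bernoulli[OF fin nb insert.prems(4,5)])
  have "?E (insert (a k) (insert (b k) ?A)) ?G =
      p * ?E (insert (b k) ?A) (\<lambda>g. ?G (g(a k := True))) +
      (1 - p) * ?E (insert (b k) ?A) (\<lambda>g. ?G (g(a k := False)))"
    by (rule expectation_Pi_pmf_insert_bernoulli[OF _ na insert.prems(4,5)]) (use fin in simp)
  also have "\<dots> = p * (p * joint_mean p (card K) (\<lambda>s t. F (Suc s) (Suc t)) +
        (1 - p) * joint_mean p (card K) (\<lambda>s t. F s (Suc t))) +
      (1 - p) * (p * joint_mean p (card K) (\<lambda>s t. F s (Suc t)) + (1 - p) * joint_mean p (card K) F)"
    unfolding Eb S T
    by (simp only: simp_thms if_True if_False IH[of "\<lambda>s t. F (Suc s) (Suc t)"]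
        IH[of "\<lambda>s t. F s (Suc t)"] IH[of F])
  also have "\<dots> = joint_mean p (card (insert k K)) F"
    using insert.hyps by (simp add: algebra_simps power2_eq_square)
  finally show ?case
    unfolding eq .
qed

section \<open>Linearity and monotonicity of \<open>joint_mean\<close>\<close>

lemma joint_mean_add:
  "joint_mean p m (\<lambda>s t. F s t + G s t) = joint_mean p m F + joint_mean p m G"
  by (induction m arbitrary: F G) (simp_all add: algebra_simps)

lemma joint_mean_cmult: "joint_mean p m (\<lambda>s t. c * F s t) = c * joint_mean p m F"
  by (induction m arbitrary: F) (simp_all add: algebra_simps)

lemma joint_mean_diff:
  "joint_mean p m (\<lambda>s t. F s t - G s t) = joint_mean p m F - joint_mean p m G"
  using joint_mean_add[of p m F "\<lambda>s t. - 1 * G s t"] joint_mean_cmult[of p m "- 1" G] by simp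

lemma joint_mean_const: "joint_mean p m (\<lambda>s t. c) = c"
  by (induction m) (simp_all add: algebra_simps power2_eq_square)

lemma joint_mean_mono:
  assumes "\<And>s t. F s t \<le> G s t" "0 \<le> p" "p \<le> 1"
  shows "joint_mean p m F \<le> joint_mean p m G"
  using assms(1)
  by (induction m arbitrary: F G)
     (use assms(2,3) in \<open>auto intro!: add_mono mult_left_mono\<close>)

section \<open>Conditional mean and variance of \<open>S\<close> given \<open>T\<close>\<close>

text \<open>Given that a vertex is adjacent to at least one of the two, it is adjacent to both with
  probability \<open>p / (2 - p)\<close>, so \<open>S - p / (2 - p) * T\<close> is a sum of terms centred conditionally
  on \<open>T\<close>.\<close>

lemma joint_mean_centred:
  assumes "p \<le> 1"
  shows "joint_mean p m (\<lambda>s t. (real s - p / (2 - p) * real t) * h t) = 0"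
proof (induction m arbitrary: h)
  case 0
  then show ?case by simp
next
  case (Suc m)
  define q where "q = p / (2 - p)"
  \<comment> \<open>Both sides are \<open>p * (2 - p) * q * (1 - q)\<close>: the increment
    \<open>1 - q\<close> from a common neighbour balances the increment \<open>- q\<close> from a
    vertex joined to just one of the two.\<close>
  have q: "p\<^sup>2 * (1 - q) = 2 * p * (1 - p) * q"
    using assms by (simp add: q_def field_simps power2_eq_square)
  have IH: "joint_mean p m (\<lambda>s t. (real s - q * real t) * g t) = 0" for g
    using Suc by (simp add: q_def)
  have 1: "joint_mean p m (\<lambda>s t. (real (Suc s) - q * real (Suc t)) * h (Suc t)) =
      (1 - q) * joint_mean p m (\<lambda>s t. h (Suc t))"
  proof -
    have "(\<lambda>s t. (real (Suc s) - q * real (Suc t)) * h (Suc t)) =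
        (\<lambda>s t. (real s - q * real t) * h (Suc t) + (1 - q) * h (Suc t))"
      by (intro ext) (simp add: algebra_simps)
    then show ?thesis
      using IH[of "\<lambda>t. h (Suc t)"] by (simp add: joint_mean_add joint_mean_cmult)
  qed
  have 2: "joint_mean p m (\<lambda>s t. (real s - q * real (Suc t)) * h (Suc t)) =
      - q * joint_mean p m (\<lambda>s t. h (Suc t))"
  proof -
    have "(\<lambda>s t. (real s - q * real (Suc t)) * h (Suc t)) =
        (\<lambda>s t. (real s - q * real t) * h (Suc t) + (- q) * h (Suc t))"
      by (intro ext) (simp add: algebra_simps)
    then show ?thesis
      using IH[of "\<lambda>t. h (Suc t)"] by (simp only: joint_mean_add joint_mean_cmult)
  qed
  have "joint_mean p (Suc m) (\<lambda>s t. (real s - q * real t) * h t) =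
      (p\<^sup>2 * (1 - q) - 2 * p * (1 - p) * q) * joint_mean p m (\<lambda>s t. h (Suc t))"
    unfolding joint_mean.simps 1 2 IH by (simp add: algebra_simps)
  then show ?case
    using q by (simp add: q_def)
qed

text \<open>Given \<open>T\<close>, the binomial \<open>S\<close> has variance
  \<open>q (1 - q) T\<close> with \<open>q = p / (2 - p)\<close>. The weight \<open>h\<close> stands
  in for conditioning on \<open>T\<close>; it is arbitrary because the recursion shifts it.\<close>

lemma joint_mean_centred_square:
  assumes "p \<le> 1"
  shows "joint_mean p m (\<lambda>s t. (real s - p / (2 - p) * real t)\<^sup>2 * h t) =
    p / (2 - p) * (1 - p / (2 - p)) * joint_mean p m (\<lambda>s t. real t * h t)"
proof (induction m arbitrary: h)
  case 0
  then show ?case by simp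
next
  case (Suc m)
  define q where "q = p / (2 - p)"
  \<comment> \<open>\<open>w\<close> is the probability of being a joint neighbour, and
    \<open>q\<close> that of then being a common one.\<close>
  define w where "w = p * (2 - p)"
  have q: "p\<^sup>2 = w * q" "2 * p * (1 - p) = w * (1 - q)"
    using assms by (simp_all add: q_def w_def field_simps power2_eq_square)
  have IH: "joint_mean p m (\<lambda>s t. (real s - q * real t)\<^sup>2 * g t) =
      q * (1 - q) * joint_mean p m (\<lambda>s t. real t * g t)" for g
    using Suc by (simp add: q_def)
  have centred: "joint_mean p m (\<lambda>s t. (real s - q * real t) * g t) = 0" for g
    using joint_mean_centred[OF assms] by (simp add: q_def)
  let ?H = "joint_mean p m (\<lambda>s t. h (Suc t))"
  let ?TH = "joint_mean p m (\<lambda>s t. real t * h (Suc t))"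
  \<comment> \<open>The cross term has mean zero by centring. A new joint neighbour contributes
    \<open>c = 1 - q\<close> or \<open>c = - q\<close>.\<close>
  have shift: "joint_mean p m (\<lambda>s t. (real s - q * real t + c)\<^sup>2 * h (Suc t)) =
      q * (1 - q) * ?TH + c\<^sup>2 * ?H" for c
  proof -
    have "(\<lambda>s t. (real s - q * real t + c)\<^sup>2 * h (Suc t)) =
        (\<lambda>s t. (real s - q * real t)\<^sup>2 * h (Suc t) +
          2 * c * ((real s - q * real t) * h (Suc t)) + c\<^sup>2 * h (Suc t))"
      by (intro ext) (simp add: algebra_simps power2_eq_square)
    then show ?thesis
      using IH[of "\<lambda>t. h (Suc t)"] centred[of "\<lambda>t. h (Suc t)"]
      by (simp only: joint_mean_add joint_mean_cmult)
  qed
  have 1: "joint_mean p m (\<lambda>s t. (real (Suc s) - q * real (Suc t))\<^sup>2 * h (Suc t)) =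
      q * (1 - q) * ?TH + (1 - q)\<^sup>2 * ?H"
    using shift[of "1 - q"] by (simp add: algebra_simps)
  have 2: "joint_mean p m (\<lambda>s t. (real s - q * real (Suc t))\<^sup>2 * h (Suc t)) =
      q * (1 - q) * ?TH + q\<^sup>2 * ?H"
    using shift[of "- q"] by (simp add: algebra_simps)
  have 3: "joint_mean p m (\<lambda>s t. real (Suc t) * h (Suc t)) = ?TH + ?H"
    by (simp add: algebra_simps joint_mean_add)
  have "joint_mean p (Suc m) (\<lambda>s t. (real s - q * real t)\<^sup>2 * h t) =
      q * (1 - q) * joint_mean p (Suc m) (\<lambda>s t. real t * h t)"
    unfolding joint_mean.simps 1 2 3 IH q by (simp add: algebra_simps power2_eq_square)
  then show ?case
    by (simp add: q_def)
qed

section \<open>Size biasing and the mean of \<open>1 / T\<close>\<close>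

text \<open>\<open>T\<close> is a sum of \<open>m + 1\<close> independent indicators of mean
  \<open>p (2 - p)\<close>; given that one of them is 1, the others sum to the count over
  \<open>m\<close> vertices.\<close>

lemma joint_mean_size_biased:
  "joint_mean p (Suc m) (\<lambda>s t. real t * g t) =
    real (Suc m) * (p * (2 - p)) * joint_mean p m (\<lambda>s t. g (Suc t))"
proof (induction m arbitrary: g)
  case 0
  then show ?case by (simp add: algebra_simps power2_eq_square)
next
  case (Suc m)
  define w where "w = p * (2 - p)"
  define X where "X = joint_mean p (Suc m) (\<lambda>s t. g (Suc t))"
  define Y where "Y = joint_mean p m (\<lambda>s t. g (Suc (Suc t)))"
  define Z where "Z = joint_mean p m (\<lambda>s t. g (Suc t))"
  \<comment> \<open>For a function of \<open>t\<close> alone the two adjacent cases merge, as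
    \<open>p^2 + 2 p (1 - p) = w\<close>.\<close>
  have *: "joint_mean p (Suc n) (\<lambda>s t. h t) =
      w * joint_mean p n (\<lambda>s t. h (Suc t)) + (1 - w) * joint_mean p n (\<lambda>s t. h t)" for n h
    by (simp add: w_def algebra_simps power2_eq_square)
  have X: "X = w * Y + (1 - w) * Z"
    unfolding X_def Y_def Z_def by (rule *)
  have "(\<lambda>s t. real (Suc t) * g (Suc t)) = (\<lambda>s t. real t * g (Suc t) + g (Suc t))"
    by (intro ext) (simp add: algebra_simps)
  then have "joint_mean p (Suc m) (\<lambda>s t. real (Suc t) * g (Suc t)) =
      joint_mean p (Suc m) (\<lambda>s t. real t * g (Suc t) + g (Suc t))"
    by (rule arg_cong)
  also have "\<dots> = real (Suc m) * w * Y + X"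
    unfolding joint_mean_add Suc X_def Y_def w_def ..
  finally have "joint_mean p (Suc (Suc m)) (\<lambda>s t. real t * g t) =
      w * (real (Suc m) * w * Y + X) + (1 - w) * (real (Suc m) * w * Z)"
    by (simp only: *[of "Suc m" "\<lambda>t. real t * g t"] Suc w_def Z_def)
  also have "\<dots> = real (Suc m) * w * (w * Y + (1 - w) * Z) + w * X"
    by (simp add: algebra_simps)
  also have "\<dots> = real (Suc (Suc m)) * w * X"
    unfolding X [symmetric] by (simp add: algebra_simps)
  finally show ?case
    unfolding X_def w_def .
qed

text \<open>Size biasing with \<open>g t = 1 / t\<close> leaves the mean of
  \<open>t * (1 / t)\<close>, which is the probability of \<open>T > 0\<close> since
  \<open>1 / 0 = 0\<close>.\<close>

lemma joint_mean_inverse_Suc_le: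
  assumes "0 < p" "p \<le> 1"
  shows "joint_mean p m (\<lambda>s t. 1 / real (Suc t)) \<le> 1 / (real (Suc m) * (p * (2 - p)))"
proof -
  define c where "c = real (Suc m) * (p * (2 - p))"
  have "c > 0"
    using assms by (simp add: c_def)
  have "c * joint_mean p m (\<lambda>s t. 1 / real (Suc t)) =
      joint_mean p (Suc m) (\<lambda>s t. real t * (1 / real t))"
    unfolding c_def by (rule joint_mean_size_biased [symmetric])
  also have "\<dots> \<le> joint_mean p (Suc m) (\<lambda>s t. 1)"
    using assms by (intro joint_mean_mono) auto
  also have "\<dots> = 1"
    by (rule joint_mean_const)
  finally show ?thesis
    unfolding c_def [symmetric] using \<open>c > 0\<close> by (simp add: pos_le_divide_eq mult.commute)
qed

text \<open>Size biasing with \<open>g t = 1 / (t (t + 1))\<close> reduces this to the previous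
  bound on one more vertex, whose factor \<open>m + 2\<close> is relaxed to
  \<open>m + 1\<close>.\<close>

lemma joint_mean_inverse_Suc_mult_le:
  assumes "0 < p" "p \<le> 1"
  shows "joint_mean p m (\<lambda>s t. 1 / (real (Suc t) * real (Suc (Suc t)))) \<le>
    1 / (real (Suc m) * (p * (2 - p)))\<^sup>2"
proof -
  define c where "c = real (Suc m) * (p * (2 - p))"
  have "c > 0"
    using assms by (simp add: c_def)
  have "c * joint_mean p m (\<lambda>s t. 1 / (real (Suc t) * real (Suc (Suc t)))) =
      joint_mean p (Suc m) (\<lambda>s t. real t * (1 / (real t * real (Suc t))))"
    unfolding c_def by (rule joint_mean_size_biased [symmetric])
  also have "\<dots> \<le> joint_mean p (Suc m) (\<lambda>s t. 1 / real (Suc t))"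
    using assms by (intro joint_mean_mono) auto
  also have "\<dots> \<le> 1 / (real (Suc (Suc m)) * (p * (2 - p)))"
    using assms by (rule joint_mean_inverse_Suc_le)
  also have "\<dots> \<le> 1 / c"
    unfolding c_def using assms by (intro divide_left_mono mult_right_mono mult_pos_pos) auto
  finally show ?thesis
    unfolding c_def [symmetric] using \<open>c > 0\<close>
    by (simp add: pos_le_divide_eq power2_eq_square mult_ac)
qed

text \<open>Size biasing gives reciprocals of shifted counts, so \<open>1 / t\<close> is majorised
  by a combination of these.\<close>

lemma joint_mean_inverse_upper:
  assumes "0 < p" "p \<le> 1"
  shows "joint_mean p m (\<lambda>s t. 1 / real t) \<le>
    1 / (real (Suc m) * (p * (2 - p))) + 3 / (real (Suc m) * (p * (2 - p)))\<^sup>2"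
proof -
  have "joint_mean p m (\<lambda>s t. 1 / real t) \<le>
      joint_mean p m (\<lambda>s t. 1 / real (Suc t) + 3 * (1 / (real (Suc t) * real (Suc (Suc t)))))"
  proof (rule joint_mean_mono)
    fix t :: nat
    show "1 / real t \<le> 1 / real (Suc t) + 3 * (1 / (real (Suc t) * real (Suc (Suc t))))"
    proof (cases "t = 0")
      case False
      define x where "x = real t"
      have x: "x \<ge> 1"
        using False by (simp add: x_def)
      \<comment> \<open>Cross-multiplied, this is \<open>2 \<le> 2 * x\<close>; the constant 3 is
        sharp at \<open>x = 1\<close>.\<close>
      have "1 / x \<le> (x + 5) / ((x + 1) * (x + 2))"
        using x by (simp add: divide_simps) (simp add: algebra_simps)
      also have "\<dots> = 1 / (x + 1) + 3 * (1 / ((x + 1) * (x + 2)))"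
        using x by (simp add: divide_simps)
      finally show ?thesis
        by (simp add: x_def add.commute)
    qed simp
  qed (use assms in auto)
  also have "\<dots> = joint_mean p m (\<lambda>s t. 1 / real (Suc t)) +
      3 * joint_mean p m (\<lambda>s t. 1 / (real (Suc t) * real (Suc (Suc t))))"
    by (simp only: joint_mean_add joint_mean_cmult)
  finally show ?thesis
    using joint_mean_inverse_Suc_le[OF assms, of m] joint_mean_inverse_Suc_mult_le[OF assms, of m]
    by simp
qed

text \<open>The cubic bound \<open>3 u\<^sup>2 - 2 u\<^sup>3 \<le> 1\<close> with \<open>u = t / E[T]\<close> bounds \<open>1 / t\<close> from below by a
  polynomial that vanishes at \<open>t = 0\<close>, so the event \<open>T = 0\<close> needs no separate estimate.\<close>

lemma joint_mean_inverse_lower: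
  assumes "0 < p" "p \<le> 1" "m > 0"
  shows "1 / (real m * (p * (2 - p))) - 2 / (real m * (p * (2 - p)))\<^sup>2 \<le>
    joint_mean p m (\<lambda>s t. 1 / real t)"
proof -
  define w where "w = p * (2 - p)"
  define \<mu> where "\<mu> = real m * w"
  define c where "c = 1 / \<mu>"
  have w: "w > 0"
    using assms by (simp add: w_def)
  have \<mu>: "\<mu> > 0"
    using w assms by (simp add: \<mu>_def)
  obtain l where l: "m = Suc l"
    using assms(3) gr0_implies_Suc by blast
  have ET: "joint_mean p n (\<lambda>s t. real t) = real n * w" for n
    using joint_mean_size_biased[of p _ "\<lambda>_. 1"]
    by (cases n) (simp_all add: joint_mean_const w_def del: joint_mean.simps(2))
  \<comment> \<open>Size biasing with \<open>g\<close> the identity; the bound then relaxes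
    \<open>l w\<close> to \<open>m w\<close>.\<close>
  have "joint_mean p m (\<lambda>s t. (real t)\<^sup>2) = \<mu> * joint_mean p l (\<lambda>s t. real t + 1)"
    using joint_mean_size_biased[of p l real]
    by (simp add: l power2_eq_square \<mu>_def w_def add.commute del: joint_mean.simps)
  also have "\<dots> = \<mu> * (real l * w + 1)"
    by (simp add: joint_mean_add joint_mean_const ET)
  also have "\<dots> \<le> \<mu> * (\<mu> + 1)"
    using \<mu> w by (simp add: l \<mu>_def)
  finally have ET2: "joint_mean p m (\<lambda>s t. (real t)\<^sup>2) \<le> \<mu> * (\<mu> + 1)" .
  \<comment> \<open>Dividing the cubic bound by \<open>t\<close>, with \<open>u = c t\<close>, gives
    a quadratic minorant of \<open>1 / t\<close>, so two moments of \<open>T\<close>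
    suffice.\<close>
  have "3 * c\<^sup>2 * \<mu> - 2 * c ^ 3 * (\<mu> * (\<mu> + 1)) \<le>
      3 * c\<^sup>2 * \<mu> - 2 * c ^ 3 * joint_mean p m (\<lambda>s t. (real t)\<^sup>2)"
    using ET2 \<mu> by (intro diff_left_mono mult_left_mono) (auto simp: c_def)
  also have "\<dots> = joint_mean p m (\<lambda>s t. 3 * c\<^sup>2 * real t - 2 * c ^ 3 * (real t)\<^sup>2)"
    by (simp add: joint_mean_diff joint_mean_cmult ET \<mu>_def)
  also have "\<dots> \<le> joint_mean p m (\<lambda>s t. 1 / real t)"
  proof (rule joint_mean_mono)
    fix t :: nat
    show "3 * c\<^sup>2 * real t - 2 * c ^ 3 * (real t)\<^sup>2 \<le> 1 / real t"
    proof (cases "t = 0")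
      case False
      define u where "u = c * real t"
      have "u \<ge> 0"
        using \<mu> by (simp add: u_def c_def)
      \<comment> \<open>This product expands to \<open>1 - 3 u^2 + 2 u^3\<close>.\<close>
      then have "0 \<le> (1 - u)\<^sup>2 * (1 + 2 * u)"
        by simp
      then have "3 * u\<^sup>2 - 2 * u ^ 3 \<le> 1"
        by (simp add: algebra_simps power2_eq_square power3_eq_cube)
      then have "(3 * c\<^sup>2 * real t - 2 * c ^ 3 * (real t)\<^sup>2) * real t \<le> 1"
        by (simp add: u_def algebra_simps power2_eq_square power3_eq_cube)
      then show ?thesis
        using False by (simp add: field_simps)
    qed simp
  qed (use assms in auto)
  also have "3 * c\<^sup>2 * \<mu> - 2 * c ^ 3 * (\<mu> * (\<mu> + 1)) = 1 / \<mu> - 2 / \<mu>\<^sup>2"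
    using \<mu> by (simp add: c_def field_simps power2_eq_square power3_eq_cube)
  finally show ?thesis
    by (simp add: \<mu>_def w_def)
qed

text \<open>Both bounds on the mean of \<open>1 / T\<close> are rescaled with
  \<open>m = n - 2\<close>; the error can be stated in \<open>n p\<close> because
  \<open>p \<le> p (2 - p)\<close>.\<close>

lemma joint_mean_inverse_asymp:
  assumes "0 < p" "p \<le> 1" "n \<ge> 4"
  shows "\<bar>real n * (p * (2 - p)) * joint_mean p (n - 2) (\<lambda>s t. 1 / real t) - 1\<bar> \<le> 14 / (real n * p)"
proof -
  define w where "w = p * (2 - p)"
  define E where "E = joint_mean p (n - 2) (\<lambda>s t. 1 / real t)"
  define N where "N = real n"
  have N: "N \<ge> 4"
    using assms by (simp add: N_def)
  have w: "0 < w" "w \<le> 1" "p \<le> w"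
    using assms sum_squares_ge_zero[of "1 - p" 0] by (auto simp: w_def algebra_simps)
  have m: "real (n - 2) = N - 2" "real (Suc (n - 2)) = N - 1"
    using assms by (auto simp: N_def)
  have U: "E \<le> 1 / ((N - 1) * w) + 3 / ((N - 1) * w)\<^sup>2"
    using joint_mean_inverse_upper[OF assms(1,2), of "n - 2"] unfolding m w_def E_def .
  have L: "1 / ((N - 2) * w) - 2 / ((N - 2) * w)\<^sup>2 \<le> E"
    using joint_mean_inverse_lower[OF assms(1,2), of "n - 2"] assms(3) unfolding m w_def E_def
    by simp
  have Nw: "N * w > 0"
    using N w by simp
  have "N * w * E \<le> N * w * (1 / ((N - 1) * w) + 3 / ((N - 1) * w)\<^sup>2)"
    using U Nw by (intro mult_left_mono) auto
  also have "\<dots> = N / (N - 1) + 3 * (N / (N - 1))\<^sup>2 / (N * w)"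
  proof -
    define M where "M = N - 1"
    have "M > 0"
      using N by (simp add: M_def)
    then show ?thesis
      unfolding M_def [symmetric] using N w by (simp add: field_simps power2_eq_square)
  qed
  \<comment> \<open>As \<open>N \<ge> 4\<close>, the ratio \<open>N / (N - 1)\<close> is at most
    \<open>1 + 2 / N\<close> and at most 2; the constant 14 is \<open>2 + 3 * 2^2\<close>.\<close>
  also have "\<dots> \<le> (1 + 2 / (N * w)) + 3 * 2\<^sup>2 / (N * w)"
  proof (rule add_mono)
    have "N / (N - 1) \<le> 1 + 2 / N"
      using N by (simp add: field_simps)
    also have "2 / N \<le> 2 / (N * w)"
      using N w by (simp add: field_simps)
    finally show "N / (N - 1) \<le> 1 + 2 / (N * w)"
      by simp
    have "N / (N - 1) \<le> 2"
      using N by (simp add: field_simps)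
    then show "3 * (N / (N - 1))\<^sup>2 / (N * w) \<le> 3 * 2\<^sup>2 / (N * w)"
      using Nw N by (intro divide_right_mono mult_left_mono power_mono) auto
  qed
  finally have upper: "N * w * E - 1 \<le> 14 / (N * w)"
    by simp
  have "1 - 2 * 2\<^sup>2 / (N * w) \<le> N / (N - 2) - 2 * (N / (N - 2))\<^sup>2 / (N * w)"
  proof (rule diff_mono)
    show "1 \<le> N / (N - 2)"
      using N by (simp add: field_simps)
    have "N / (N - 2) \<le> 2"
      using N by (simp add: field_simps)
    then show "2 * (N / (N - 2))\<^sup>2 / (N * w) \<le> 2 * 2\<^sup>2 / (N * w)"
      using Nw N by (intro divide_right_mono mult_left_mono power_mono) auto
  qed
  also have "\<dots> = N * w * (1 / ((N - 2) * w) - 2 / ((N - 2) * w)\<^sup>2)"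
  proof -
    define M where "M = N - 2"
    have "M > 0"
      using N by (simp add: M_def)
    then show ?thesis
      unfolding M_def [symmetric] using N w by (simp add: field_simps power2_eq_square)
  qed
  also have "\<dots> \<le> N * w * E"
    using L Nw by (intro mult_left_mono) auto
  finally have "- (8 / (N * w)) \<le> N * w * E - 1"
    by simp
  moreover have "8 / (N * w) \<le> 14 / (N * w)"
    using Nw by (intro divide_right_mono) auto
  ultimately have lower: "- (14 / (N * w)) \<le> N * w * E - 1"
    by linarith
  have "14 / (N * w) \<le> 14 / (N * p)"
    using N w assms by (intro divide_left_mono mult_left_mono) auto
  with upper lower show ?thesis
    by (simp add: N_def w_def E_def abs_le_iff)
qed

section \<open>Transfer to the random graph: mean, variance and deviations of the Jaccard
  index\<close>

lemma finite_edges: "finite (edges n)"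
  by (rule finite_subset[of _ "Pow {1..n}"]) (auto simp: edges_def)

lemma finite_set_er_graph: "finite (set_pmf (er_graph n p))"
  by (auto simp: er_graph_def set_Pi_pmf finite_edges)

text \<open>Writing \<open>J - p / (2 - p)\<close> as \<open>(S - p / (2 - p) * T) / T\<close> also covers the convention for
  \<open>T = 0\<close>, since division by zero yields zero.\<close>

lemma jaccard_eq_centred:
  assumes "i \<noteq> j"
  shows "jaccard n p i j g = p / (2 - p) +
    (real (card {k \<in> {1..n} - {i, j}. g {i, k} \<and> g {j, k}}) -
      p / (2 - p) * real (card {k \<in> {1..n} - {i, j}. g {i, k} \<or> g {j, k}})) /
    real (card {k \<in> {1..n} - {i, j}. g {i, k} \<or> g {j, k}})"
proof -
  let ?K = "{1..n} - {i, j}"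
  have S: "common_nbrs n g i j = real (card {k \<in> ?K. g {i, k} \<and> g {j, k}})"
  proof -
    have "common_nbrs n g i j = (\<Sum>k\<in>?K. if g {i, k} \<and> g {j, k} then 1 else 0)"
      unfolding common_nbrs_def by (intro sum.cong) (auto simp: edge_ind_def)
    then show ?thesis
      by (simp add: sum.If_cases Int_def)
  qed
  have T: "union_nbrs n g i j = real (card {k \<in> ?K. g {i, k} \<or> g {j, k}})"
  proof -
    have "union_nbrs n g i j = (\<Sum>k\<in>?K. if g {i, k} \<or> g {j, k} then 1 else 0)"
      unfolding union_nbrs_def by (intro sum.cong) (auto simp: edge_ind_def)
    then show ?thesis
      by (simp add: sum.If_cases Int_def)
  qed
  have "(if real t > 0 then real s / real t else q) = q + (real s - q * real t) / real t"
    for s t :: nat and q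
    by (cases "t = 0") (simp_all add: diff_divide_distrib)
  then show ?thesis
    unfolding jaccard_def S T .
qed

text \<open>The index depends only on the edges from \<open>i\<close> or \<open>j\<close> to third
  vertices, and these form two disjoint families indexed by the \<open>n - 2\<close> remaining
  vertices.\<close>

lemma expectation_er_graph_jaccard:
  fixes \<Phi> :: "real \<Rightarrow> real"
  assumes "i \<in> {1..n}" "j \<in> {1..n}" "i \<noteq> j" "0 \<le> p" "p \<le> 1"
  shows "measure_pmf.expectation (er_graph n p) (\<lambda>g. \<Phi> (jaccard n p i j g)) =
    joint_mean p (n - 2)
      (\<lambda>s t. \<Phi> (p / (2 - p) + (real s - p / (2 - p) * real t) / real t))"
proof -
  let ?K = "{1..n} - {i, j}"
  let ?A = "(\<lambda>k. {i, k}) ` ?K \<union> (\<lambda>k. {j, k}) ` ?K"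
  let ?F = "\<lambda>s t. \<Phi> (p / (2 - p) + (real s - p / (2 - p) * real t) / real t)"
  have sub: "?A \<subseteq> edges n"
    using assms by (auto simp: edges_def)
  have card: "card ?K = n - 2"
    using assms by (simp add: card_Diff_subset)
  \<comment> \<open>Marginalising sets every coordinate outside \<open>?A\<close> to
    \<open>False\<close>, which the two counts do not see.\<close>
  have restrict:
    "{k \<in> ?K. (if {i, k} \<in> ?A then g {i, k} else False) \<and> (if {j, k} \<in> ?A then g {j, k} else False)} =
       {k \<in> ?K. g {i, k} \<and> g {j, k}}"
    "{k \<in> ?K. (if {i, k} \<in> ?A then g {i, k} else False) \<or> (if {j, k} \<in> ?A then g {j, k} else False)} =
       {k \<in> ?K. g {i, k} \<or> g {j, k}}" for g :: "nat set \<Rightarrow> bool"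
    by (intro Collect_cong conj_cong refl; simp)+
  have "joint_mean p (n - 2) ?F = measure_pmf.expectation (Pi_pmf ?A False (\<lambda>_. bernoulli_pmf p))
      (\<lambda>g. ?F (card {k \<in> ?K. g {i, k} \<and> g {j, k}}) (card {k \<in> ?K. g {i, k} \<or> g {j, k}}))"
  proof -
    have "inj_on (\<lambda>k. {i, k}) ?K" "inj_on (\<lambda>k. {j, k}) ?K"
      by (simp_all add: inj_on_def doubleton_eq_iff)
    moreover have "(\<lambda>k. {i, k}) ` ?K \<inter> (\<lambda>k. {j, k}) ` ?K = {}"
      using assms(3) by (auto simp: doubleton_eq_iff)
    ultimately show ?thesis
      using expectation_Pi_pmf_counts[of ?K "\<lambda>k. {i, k}" "\<lambda>k. {j, k}" p ?F] assms(4,5)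
      by (simp only: card finite_Diff finite_atLeastAtMost)
  qed
  also have "\<dots> = measure_pmf.expectation (er_graph n p)
      (\<lambda>g. ?F (card {k \<in> ?K. g {i, k} \<and> g {j, k}}) (card {k \<in> ?K. g {i, k} \<or> g {j, k}}))"
    unfolding er_graph_def Pi_pmf_subset[OF finite_edges sub] integral_map_pmf restrict ..
  also have "\<dots> = measure_pmf.expectation (er_graph n p) (\<lambda>g. \<Phi> (jaccard n p i j g))"
    using assms(3) by (simp add: jaccard_eq_centred)
  finally show ?thesis ..
qed

text \<open>Centring with the weight \<open>1 / t\<close>, whose value 0 at \<open>t = 0\<close>
  matches the convention.\<close>

lemma expectation_jaccard:
  assumes "i \<in> {1..n}" "j \<in> {1..n}" "i \<noteq> j" "0 \<le> p" "p \<le> 1"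
  shows "measure_pmf.expectation (er_graph n p) (jaccard n p i j) = p / (2 - p)"
proof -
  have "measure_pmf.expectation (er_graph n p) (jaccard n p i j) =
      joint_mean p (n - 2)
        (\<lambda>s t. p / (2 - p) + (real s - p / (2 - p) * real t) * (1 / real t))"
    unfolding times_divide_eq_right mult_1_right
    by (rule expectation_er_graph_jaccard[OF assms, of "\<lambda>x. x"])
  also have "\<dots> = p / (2 - p)"
    unfolding joint_mean_add joint_mean_const
      joint_mean_centred[OF assms(5), of "n - 2" "\<lambda>t. 1 / real t"] by simp
  finally show ?thesis .
qed

text \<open>The squared deviation carries the weight \<open>1 / t^2\<close>, and
  \<open>t * (1 / t^2) = 1 / t\<close> holds also at \<open>t = 0\<close>.\<close>

lemma variance_jaccard:
  assumes "i \<in> {1..n}" "j \<in> {1..n}" "i \<noteq> j" "0 \<le> p" "p \<le> 1"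
  shows "measure_pmf.variance (er_graph n p) (jaccard n p i j) =
    p / (2 - p) * (1 - p / (2 - p)) * joint_mean p (n - 2) (\<lambda>s t. 1 / real t)"
proof -
  let ?q = "p / (2 - p)"
  have "measure_pmf.variance (er_graph n p) (jaccard n p i j) =
      joint_mean p (n - 2) (\<lambda>s t. (?q + (real s - ?q * real t) / real t - ?q)\<^sup>2)"
    unfolding expectation_jaccard[OF assms]
    by (rule expectation_er_graph_jaccard[OF assms, of "\<lambda>x. (x - ?q)\<^sup>2"])
  also have "(\<lambda>s t. (?q + (real s - ?q * real t) / real t - ?q)\<^sup>2) =
      (\<lambda>s t. (real s - ?q * real t)\<^sup>2 * (1 / (real t)\<^sup>2))"
    by (simp only: add_diff_cancel_left' power_divide times_divide_eq_right mult_1_right)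
  also have "joint_mean p (n - 2) \<dots> =
      ?q * (1 - ?q) * joint_mean p (n - 2) (\<lambda>s t. real t * (1 / (real t)\<^sup>2))"
    by (rule joint_mean_centred_square[OF assms(5)])
  also have "(\<lambda>(s::nat) t. real t * (1 / (real t)\<^sup>2)) = (\<lambda>s t. 1 / real t)"
    by (auto simp: power2_eq_square fun_eq_iff)
  finally show ?thesis .
qed

lemma prob_jaccard_deviation_le:
  assumes "i \<in> {1..n}" "j \<in> {1..n}" "i \<noteq> j" "0 \<le> p" "p \<le> 1" "\<epsilon> > 0"
  shows "measure_pmf.prob (er_graph n p) {g. \<bar>jaccard n p i j g - p / (2 - p)\<bar> > \<epsilon>} \<le>
    measure_pmf.variance (er_graph n p) (jaccard n p i j) / \<epsilon>\<^sup>2"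
proof -
  \<comment> \<open>Convergence in probability is stated with a strict inequality, Chebyshev with a
    weak one.\<close>
  have "measure_pmf.prob (er_graph n p) {g. \<bar>jaccard n p i j g - p / (2 - p)\<bar> > \<epsilon>} \<le>
      measure_pmf.prob (er_graph n p) {g. \<bar>jaccard n p i j g - p / (2 - p)\<bar> \<ge> \<epsilon>}"
    by (intro measure_pmf.finite_measure_mono) auto
  also have "\<dots> \<le> measure_pmf.variance (er_graph n p) (jaccard n p i j) / \<epsilon>\<^sup>2"
    using measure_pmf.Chebyshev_inequality[of "jaccard n p i j" "er_graph n p" \<epsilon>] assms(6)
    unfolding expectation_jaccard[OF assms(1-5)]
    by (simp add: integrable_measure_pmf_finite finite_set_er_graph)
  finally show ?thesis .
qed

section \<open>Asymptotics along a sequence of edge probabilities\<close>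

theorem proposition1:
  fixes p :: "nat \<Rightarrow> real"
  assumes "\<And>n. n \<ge> 2 \<Longrightarrow> 0 \<le> p n \<and> p n \<le> 1"
  shows "(\<forall>n\<ge>2. \<forall>i\<in>{1..n}. \<forall>j\<in>{1..n}. i \<noteq> j \<longrightarrow>
            measure_pmf.expectation (er_graph n (p n)) (jaccard n (p n) i j) = p n / (2 - p n)) \<and>
         (filterlim (\<lambda>n. real n * p n) at_top sequentially \<longrightarrow>
            (\<exists>r. r \<in> O[sequentially](\<lambda>n. 1 / (real n * p n)) \<and>
               (\<forall>\<^sub>F n in sequentially. \<forall>i\<in>{1..n}. \<forall>j\<in>{1..n}. i \<noteq> j \<longrightarrow>
                  measure_pmf.variance (er_graph n (p n)) (jaccard n (p n) i j) =
                    2 * (1 - p n) / (real n * (2 - p n) ^ 3) * (1 + r n))) \<and>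
            (\<forall>i j. (\<forall>\<^sub>F n in sequentially. i n \<in> {1..n} \<and> j n \<in> {1..n} \<and> i n \<noteq> j n) \<longrightarrow>
               converges_in_prob (\<lambda>n. measure_pmf (er_graph n (p n)))
                 (\<lambda>n g. jaccard n (p n) (i n) (j n) g - p n / (2 - p n)) 0))"
proof (intro conjI impI)
  show "\<forall>n\<ge>2. \<forall>i\<in>{1..n}. \<forall>j\<in>{1..n}. i \<noteq> j \<longrightarrow>
      measure_pmf.expectation (er_graph n (p n)) (jaccard n (p n) i j) = p n / (2 - p n)"
    using assms expectation_jaccard by blast
next
  assume lim: "filterlim (\<lambda>n. real n * p n) at_top sequentially"
  define E where "E n = joint_mean (p n) (n - 2) (\<lambda>s t. 1 / real t)" for n
  \<comment> \<open>This choice makes the variance formula an exact identity, so only the size of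
    \<open>r\<close> remains to be bounded.\<close>
  define r where "r n = real n * (p n * (2 - p n)) * E n - 1" for n
  have "\<forall>\<^sub>F n in sequentially. real n * p n > 1"
    using lim by (simp add: filterlim_at_top_dense)
  then have ev: "\<forall>\<^sub>F n in sequentially. n \<ge> 4 \<and> real n * p n > 1 \<and> 0 < p n \<and> p n \<le> 1"
    using eventually_ge_at_top[of 4]
  proof eventually_elim
    case (elim n)
    then show ?case
      using assms[of n] by (auto simp: less_le)
  qed
  have r_le: "\<forall>\<^sub>F n in sequentially. \<bar>r n\<bar> \<le> 14 / (real n * p n)"
    using ev
  proof eventually_elim
    case (elim n)
    then show ?case
      using joint_mean_inverse_asymp[of "p n" n] by (simp add: r_def E_def)
  qed
  have r: "r \<in> O[sequentially](\<lambda>n. 1 / (real n * p n))"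
  proof (rule bigoI[of _ 14])
    show "\<forall>\<^sub>F n in sequentially. norm (r n) \<le> 14 * norm (1 / (real n * p n))"
      using r_le ev by eventually_elim (simp add: abs_mult)
  qed
  have var: "\<forall>\<^sub>F n in sequentially. \<forall>i\<in>{1..n}. \<forall>j\<in>{1..n}. i \<noteq> j \<longrightarrow>
      measure_pmf.variance (er_graph n (p n)) (jaccard n (p n) i j) =
        2 * (1 - p n) / (real n * (2 - p n) ^ 3) * (1 + r n)"
    using ev
  proof eventually_elim
    case (elim n)
    have nz: "real n \<noteq> 0" "2 - p n \<noteq> 0"
      using elim by auto
    have "p n / (2 - p n) * (1 - p n / (2 - p n)) * E n =
        2 * (1 - p n) / (real n * (2 - p n) ^ 3) * (1 + r n)"
      using nz by (simp add: r_def divide_simps power3_eq_cube)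
    then show ?case
      using elim by (simp add: variance_jaccard E_def)
  qed
  show "\<exists>r. r \<in> O[sequentially](\<lambda>n. 1 / (real n * p n)) \<and>
      (\<forall>\<^sub>F n in sequentially. \<forall>i\<in>{1..n}. \<forall>j\<in>{1..n}. i \<noteq> j \<longrightarrow>
        measure_pmf.variance (er_graph n (p n)) (jaccard n (p n) i j) =
          2 * (1 - p n) / (real n * (2 - p n) ^ 3) * (1 + r n))"
    using r var by blast
  show "\<forall>i j. (\<forall>\<^sub>F n in sequentially. i n \<in> {1..n} \<and> j n \<in> {1..n} \<and> i n \<noteq> j n) \<longrightarrow>
      converges_in_prob (\<lambda>n. measure_pmf (er_graph n (p n)))
        (\<lambda>n g. jaccard n (p n) (i n) (j n) g - p n / (2 - p n)) 0"
    unfolding converges_in_prob_def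
  proof (intro allI impI)
    fix i j :: "nat \<Rightarrow> nat" and \<epsilon> :: real
    assume ij: "\<forall>\<^sub>F n in sequentially. i n \<in> {1..n} \<and> j n \<in> {1..n} \<and> i n \<noteq> j n" and "\<epsilon> > 0"
    let ?P = "\<lambda>n. measure_pmf.prob (er_graph n (p n))
      {g \<in> space (measure_pmf (er_graph n (p n))).
        \<epsilon> < \<bar>jaccard n (p n) (i n) (j n) g - p n / (2 - p n) - 0\<bar>}"
    \<comment> \<open>Once \<open>n p > 1\<close>, \<open>1 + r\<close> is at most
      \<open>1 + 14 = 15\<close>, and the leading factor is at most \<open>2 / n\<close>; hence the
      constant 30.\<close>
    have "\<forall>\<^sub>F n in sequentially. ?P n \<le> 30 / \<epsilon>\<^sup>2 * (1 / real n)"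
      using ev var r_le ij
    proof eventually_elim
      case (elim n)
      have "14 / (real n * p n) \<le> 14"
        using elim by (simp add: field_simps)
      then have "1 + r n \<le> 15"
        using elim by linarith
      moreover have "2 * (1 - p n) / (real n * (2 - p n) ^ 3) \<le> 2 / real n"
      proof -
        have "real n * 1 \<le> real n * (2 - p n) ^ 3"
          using elim by (intro mult_left_mono one_le_power) auto
        then show ?thesis
          using elim by (intro frac_le) auto
      qed
      ultimately have "2 * (1 - p n) / (real n * (2 - p n) ^ 3) * (1 + r n) \<le> 2 / real n * 15"
        using elim by (intro order_trans[OF mult_left_mono mult_right_mono]) auto
      then have "measure_pmf.variance (er_graph n (p n)) (jaccard n (p n) (i n) (j n)) \<le> 30 / real n"
        using elim by simp
      then have "measure_pmf.variance (er_graph n (p n)) (jaccard n (p n) (i n) (j n)) / \<epsilon>\<^sup>2 \<le>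
          30 / real n / \<epsilon>\<^sup>2"
        by (intro divide_right_mono) auto
      then show ?case
        using prob_jaccard_deviation_le[of "i n" n "j n" "p n" \<epsilon>] elim \<open>\<epsilon> > 0\<close>
        by (simp add: mult.commute)
    qed
    moreover have "(\<lambda>n. 30 / \<epsilon>\<^sup>2 * (1 / real n)) \<longlonglongrightarrow> 0"
      unfolding times_divide_eq_right mult_1_right by (rule lim_const_over_n)
    ultimately show "?P \<longlonglongrightarrow> 0"
      by (rule tendsto_sandwich[OF _ _ tendsto_const, rotated]) simp
  qed
qed

end
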